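(* Let $L$ be a distributive lattice, let $A$ be a nonempty set, let $n\in\mathbb{N}$ with $n\geq 2$, and let $T\colon L^n\to A$ be a map. The following are equivalent. (1) $T$ is total orderization invariant. (2) $T$ is symmetric and $T(x_1,x_2,x_3,\dots,x_n)=T(x_1\wedge x_2,\,x_1\vee x_2,\,x_3,\dots,x_n)$ for all $x_1,\dots,x_n\in L$. (3) $T(x_1,\dots,x_i,\dots,x_j,\dots,x_n)=T(x_1,\dots,x_i\wedge x_j,\dots,x_i\vee x_j,\dots,x_n)$ for all $x_1,\dots,x_n\in L$ and all $i,j\in\{1,\dots,n\}$, where the tuple on the right is obtained from $(x_1,\dots,x_n)$ by replacing the $i$th entry by $x_i\wedge x_j$ and the $j$th entry by $x_i\vee x_j$ (leaving the other entries unchanged). (4) $T(x_1,\dots,x_n)=T\bigl(\mathcal{M}_{1,m}(x_1,\dots,x_m),\dots,\mathcal{M}_{m,m}(x_1,\dots,x_m),x_{m+1},\dots,x_n\bigr)$ for all $x_1,\dots,x_n\in L$ and all $m\in\{2,\dots,n\}$.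
   Context: For a distributive lattice $L$, $m\in\mathbb{N}=\{1,2,\dots\}$, $x_1,\dots,x_m\in L$ and $k\in\{1,\dots,m\}$, the $k$th median of $x_1,\dots,x_m$ is $$\mathcal{M}_{k,m}(x_1,\dots,x_m)=\mathcal{M}_k(x_1,\dots,x_m):=\bigvee_{1\leq i_1<i_2<\cdots<i_{m+1-k}\leq m}\ \bigwedge_{j=1}^{m+1-k}x_{i_j}.$$ A map $T\colon L^n\to A$ is total orderization invariant if $T(x_1,\dots,x_n)=T\bigl(\mathcal{M}_1(x_1,\dots,x_n),\mathcal{M}_2(x_1,\dots,x_n),\dots,\mathcal{M}_n(x_1,\dots,x_n)\bigr)$ for all $x_1,\dots,x_n\in L$. A map $T\colon L^n\to A$ is symmetric if its value is unchanged under every permutation of its arguments. *)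

theory Defs
  imports Main "HOL-Library.FuncSet" "HOL-Combinatorics.Permutations"
begin

text \<open>
  Elements of \<open>L\<^sup>n\<close> are lists of length \<open>n\<close>, so entries are numbered from 0, whereas medians
  keep the range \<open>k \<in> {1..m}\<close>. A choice of indices \<open>i\<^sub>1 < \<dots> < i\<^sub>r\<close> is an \<open>r\<close>-element set \<open>I\<close> of
  positions; for \<open>k\<close> in this range, \<open>r = m + 1 - k\<close> lies in \<open>{1..m}\<close>, so the finite joins and
  meets below are all over nonempty sets. For other \<open>k\<close> the value is irrelevant.
\<close>

definition kth_median :: "nat \<Rightarrow> 'a::distrib_lattice list \<Rightarrow> 'a" where
  "kth_median k xs =
     Sup_fin {Inf_fin ((\<lambda>i. xs ! i) ` I) | I.
                I \<subseteq> {..<length xs} \<and> card I = length xs + 1 - k}"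

definition medians :: "'a::distrib_lattice list \<Rightarrow> 'a list" where
  "medians xs = map (\<lambda>k. kth_median k xs) [1..<length xs + 1]"

definition total_orderization_invariant ::
    "nat \<Rightarrow> ('a::distrib_lattice list \<Rightarrow> 'b) \<Rightarrow> bool" where
  "total_orderization_invariant n T \<longleftrightarrow> (\<forall>xs. length xs = n \<longrightarrow> T xs = T (medians xs))"

definition symmetric_map :: "nat \<Rightarrow> ('a list \<Rightarrow> 'b) \<Rightarrow> bool" where
  "symmetric_map n T \<longleftrightarrow>
     (\<forall>xs p. length xs = n \<longrightarrow> p permutes {..<n} \<longrightarrow> T (permute_list p xs) = T xs)"

end

theory Submission
  imports Defs
begin

text \<open>
  Prime filters, viewed as lattice homomorphisms \<open>P\<close> into \<open>bool\<close>, separate the points of a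
  distributive lattice, and \<open>P\<close> holds at the \<open>k\<close>th median of \<open>m\<close> entries iff it holds at at least
  \<open>m + 1 - k\<close> of them. Replacing \<open>x\<^sub>i, x\<^sub>j\<close> by \<open>x\<^sub>i \<sqinter> x\<^sub>j, x\<^sub>i \<squnion> x\<^sub>j\<close> does not change the number of
  entries at which \<open>P\<close> holds, so it preserves all medians. Conversely, insertion sort with such
  replacements as compare-and-swap steps turns any tuple into a chain, which is then the tuple of
  its medians.
\<close>

section \<open>Prime filters and the separation of points\<close>

text \<open>Both constant predicates qualify; a separating \<open>P\<close> is neither of
  them.\<close>

definition prime_filter :: "('a::lattice \<Rightarrow> bool) \<Rightarrow> bool" where
  "prime_filter P \<longleftrightarrow>
     (\<forall>x y. P (inf x y) \<longleftrightarrow> P x \<and> P y) \<and> (\<forall>x y. P (sup x y) \<longleftrightarrow> P x \<or> P y)"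

lemma prime_filter_inf: "prime_filter P \<Longrightarrow> P (inf x y) \<longleftrightarrow> P x \<and> P y"
  and prime_filter_sup: "prime_filter P \<Longrightarrow> P (sup x y) \<longleftrightarrow> P x \<or> P y"
  by (simp_all add: prime_filter_def)

lemma prime_filter_mono: "prime_filter P \<Longrightarrow> x \<le> y \<Longrightarrow> P x \<Longrightarrow> P y"
  by (metis inf.absorb1 prime_filter_inf)

lemma prime_filter_Inf_fin:
  assumes "prime_filter P" "finite A" "A \<noteq> {}"
  shows "P (Inf_fin A) \<longleftrightarrow> (\<forall>a\<in>A. P a)"
  using assms(2,3) by (induction A rule: finite_ne_induct) (simp_all add: prime_filter_inf[OF assms(1)])

lemma prime_filter_Sup_fin:
  assumes "prime_filter P" "finite A" "A \<noteq> {}"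
  shows "P (Sup_fin A) \<longleftrightarrow> (\<exists>a\<in>A. P a)"
  using assms(2,3) by (induction A rule: finite_ne_induct) (simp_all add: prime_filter_sup[OF assms(1)])

text \<open>By Zorn's lemma there is a filter maximal among those that contain \<open>x\<close> and
  omit \<open>y\<close>; in a distributive lattice such a filter is prime.\<close>

lemma ex_prime_filter_separating:
  fixes x y :: "'a::distrib_lattice"
  assumes "\<not> x \<le> y"
  shows "\<exists>P. prime_filter P \<and> P x \<and> \<not> P y"
proof -
  \<comment> \<open>The equivalence for \<open>inf\<close> expresses closure under meets and upward
    closure at once.\<close>
  define S :: "'a set set" where
    "S = {F. x \<in> F \<and> y \<notin> F \<and> (\<forall>a b. inf a b \<in> F \<longleftrightarrow> a \<in> F \<and> b \<in> F)}"
  have "\<exists>M\<in>S. \<forall>F\<in>S. M \<subseteq> F \<longrightarrow> F = M"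
  proof (rule subset_Zorn_nonempty)
    have "{x..} \<in> S"
      using assms by (simp add: S_def)
    then show "S \<noteq> {}" by blast
  next
    fix \<C> assume "\<C> \<noteq> {}" and chain: "subset.chain S \<C>"
    have "\<C> \<subseteq> S" and total: "\<And>F G. F \<in> \<C> \<Longrightarrow> G \<in> \<C> \<Longrightarrow> F \<subseteq> G \<or> G \<subseteq> F"
      using chain by (auto simp: subset_chain_def)
    then have filt: "\<And>F. F \<in> \<C> \<Longrightarrow> x \<in> F \<and> y \<notin> F \<and> (\<forall>a b. inf a b \<in> F \<longleftrightarrow> a \<in> F \<and> b \<in> F)"
      by (auto simp: S_def)
    \<comment> \<open>Two elements of the union already lie in a common member of the chain.\<close>
    have "inf a b \<in> \<Union>\<C> \<longleftrightarrow> a \<in> \<Union>\<C> \<and> b \<in> \<Union>\<C>" for a b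
    proof
      assume "inf a b \<in> \<Union>\<C>"
      then show "a \<in> \<Union>\<C> \<and> b \<in> \<Union>\<C>" using filt by blast
    next
      assume "a \<in> \<Union>\<C> \<and> b \<in> \<Union>\<C>"
      then obtain F G where "F \<in> \<C>" "a \<in> F" "G \<in> \<C>" "b \<in> G" by blast
      with total[of F G] filt[of F] filt[of G] show "inf a b \<in> \<Union>\<C>" by blast
    qed
    moreover have "x \<in> \<Union>\<C>" "y \<notin> \<Union>\<C>"
      using filt \<open>\<C> \<noteq> {}\<close> by blast+
    ultimately show "\<Union>\<C> \<in> S"
      by (simp add: S_def)
  qed
  then obtain M where "M \<in> S" and max: "\<And>F. F \<in> S \<Longrightarrow> M \<subseteq> F \<Longrightarrow> F = M"
    by blast
  then have "x \<in> M" "y \<notin> M" and M_inf: "\<And>a b. inf a b \<in> M \<longleftrightarrow> a \<in> M \<and> b \<in> M"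
    by (auto simp: S_def)
  have up: "b \<in> M" if "a \<in> M" "a \<le> b" for a b
    using that M_inf by (metis inf.absorb1)
  \<comment> \<open>By maximality, adjoining an outside element \<open>a\<close> to \<open>M\<close>
    must capture \<open>y\<close>.\<close>
  have gen: "\<exists>m\<in>M. inf m a \<le> y" if "a \<notin> M" for a
  proof (rule ccontr)
    assume y: "\<not> (\<exists>m\<in>M. inf m a \<le> y)"
    \<comment> \<open>The filter generated by \<open>M\<close> and \<open>a\<close>.\<close>
    define F where "F = {z. \<exists>m\<in>M. inf m a \<le> z}"
    have "inf b c \<in> F" if "b \<in> F" "c \<in> F" for b c
    proof -
      from that obtain m m' where "m \<in> M" "m' \<in> M" "inf m a \<le> b" "inf m' a \<le> c"
        by (auto simp: F_def)
      then have "inf m m' \<in> M" "inf (inf m m') a \<le> inf b c"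
        by (simp_all add: M_inf) (meson inf_le1 inf_le2 inf_mono order_refl order_trans)
      then show ?thesis by (auto simp: F_def)
    qed
    then have "inf b c \<in> F \<longleftrightarrow> b \<in> F \<and> c \<in> F" for b c
      by (auto simp: F_def)
    moreover have "M \<subseteq> F"
      by (auto simp: F_def intro: le_infI1)
    moreover have "y \<notin> F"
      using y by (simp add: F_def)
    ultimately have "F \<in> S"
      using \<open>x \<in> M\<close> by (auto simp: S_def)
    then have "F = M"
      using max \<open>M \<subseteq> F\<close> by blast
    moreover have "a \<in> F"
      using \<open>x \<in> M\<close> by (auto simp: F_def)
    ultimately show False
      using that by simp
  qed
  \<comment> \<open>Otherwise one element of \<open>M\<close> meets both \<open>a\<close> and
    \<open>b\<close> below \<open>y\<close>. By distributivity its meet with \<open>sup a b\<close>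
    is below \<open>y\<close> too, which forces \<open>y\<close> into \<open>M\<close>.\<close>
  have "a \<in> M \<or> b \<in> M" if "sup a b \<in> M" for a b
  proof (rule ccontr)
    assume "\<not> (a \<in> M \<or> b \<in> M)"
    then obtain m m' where m: "m \<in> M" "m' \<in> M" "inf m a \<le> y" "inf m' b \<le> y"
      using gen by blast
    have "inf (inf m m') a \<le> y" "inf (inf m m') b \<le> y"
      using m(3,4) by (meson inf_le1 inf_le2 inf_mono order_refl order_trans)+
    then have "inf (inf m m') (sup a b) \<le> y"
      by (simp add: inf_sup_distrib1)
    moreover have "inf (inf m m') (sup a b) \<in> M"
      using m that by (simp add: M_inf)
    ultimately show False
      using up \<open>y \<notin> M\<close> by blast
  qed
  then have "prime_filter (\<lambda>a. a \<in> M)"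
    using up by (auto simp: prime_filter_def M_inf)
  with \<open>x \<in> M\<close> \<open>y \<notin> M\<close> show ?thesis by blast
qed

lemma eq_by_prime_filters:
  fixes x y :: "'a::distrib_lattice"
  assumes "\<And>P. prime_filter P \<Longrightarrow> P x \<longleftrightarrow> P y"
  shows "x = y"
proof (rule order_antisym; rule ccontr)
  assume "\<not> x \<le> y"
  then show False
    using ex_prime_filter_separating assms by blast
next
  assume "\<not> y \<le> x"
  then show False
    using ex_prime_filter_separating assms by blast
qed

section \<open>Medians as thresholds on counts\<close>

text \<open>\<open>P\<close> turns the join into an existential and each meet into a universal
  statement. What remains is that some index set of the prescribed size lies inside the set of
  positions where \<open>P\<close> holds.\<close>

lemma prime_filter_kth_median:
  assumes P: "prime_filter P" and k: "1 \<le> k" "k \<le> length xs"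
  shows "P (kth_median k xs) \<longleftrightarrow> length xs + 1 - k \<le> length (filter P xs)"
proof -
  let ?r = "length xs + 1 - k"
  let ?J = "{i. i < length xs \<and> P (xs ! i)}"
  define \<I> where "\<I> = {I. I \<subseteq> {..<length xs} \<and> card I = ?r}"
  have "finite \<I>"
    by (rule finite_subset[of _ "Pow {..<length xs}"]) (auto simp: \<I>_def)
  \<comment> \<open>From \<open>1 \<le> k\<close> follows \<open>?r \<le> length xs\<close>, so the
    join is over a nonempty family.\<close>
  have "{..<?r} \<in> \<I>"
    using k by (auto simp: \<I>_def)
  have inf: "P (Inf_fin ((!) xs ` I)) \<longleftrightarrow> I \<subseteq> ?J" if "I \<in> \<I>" for I
  proof -
    \<comment> \<open>From \<open>k \<le> length xs\<close> follows \<open>?r > 0\<close>, so each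
      meet is over a nonempty set.\<close>
    have "I \<subseteq> {..<length xs}" "card I \<noteq> 0"
      using that k by (auto simp: \<I>_def)
    then have "finite I" "I \<noteq> {}"
      using card_eq_0_iff[of I] by simp_all
    then have "P (Inf_fin ((!) xs ` I)) \<longleftrightarrow> (\<forall>i\<in>I. P (xs ! i))"
      using prime_filter_Inf_fin[OF P, of "(!) xs ` I"] by simp
    with \<open>I \<subseteq> {..<length xs}\<close> show ?thesis by auto
  qed
  let ?M = "(\<lambda>I. Inf_fin ((!) xs ` I)) ` \<I>"
  have "kth_median k xs = Sup_fin ?M"
    unfolding kth_median_def \<I>_def by (rule arg_cong[of _ _ Sup_fin]) blast
  moreover have "finite ?M" "?M \<noteq> {}"
    using \<open>finite \<I>\<close> \<open>{..<?r} \<in> \<I>\<close> by blast+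
  ultimately have "P (kth_median k xs) \<longleftrightarrow> (\<exists>a\<in>?M. P a)"
    by (simp only: prime_filter_Sup_fin[OF P] simp_thms)
  also have "\<dots> \<longleftrightarrow> (\<exists>I\<in>\<I>. P (Inf_fin ((!) xs ` I)))"
    by (rule bex_simps(7))
  also have "\<dots> \<longleftrightarrow> (\<exists>I\<in>\<I>. I \<subseteq> ?J)"
    using inf by blast
  also have "\<dots> \<longleftrightarrow> ?r \<le> card ?J"
  proof
    assume "\<exists>I\<in>\<I>. I \<subseteq> ?J"
    then obtain I where "card I = ?r" "I \<subseteq> ?J"
      by (auto simp: \<I>_def)
    then show "?r \<le> card ?J"
      using card_mono[of ?J I] by simp
  next
    assume "?r \<le> card ?J"
    then obtain I where "I \<subseteq> ?J" "card I = ?r"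
      by (rule obtain_subset_with_card_n)
    then show "\<exists>I\<in>\<I>. I \<subseteq> ?J"
      by (intro bexI[of _ I]) (auto simp: \<I>_def)
  qed
  finally show ?thesis
    by (simp add: length_filter_conv_card)
qed

lemma length_medians [simp]: "length (medians xs) = length xs"
  by (simp add: medians_def del: upt_Suc)

text \<open>Position \<open>i\<close> carries the median with \<open>k = Suc i\<close>, so the
  threshold becomes \<open>length xs - i\<close>.\<close>

lemma prime_filter_nth_medians:
  assumes "prime_filter P" "i < length xs"
  shows "P (medians xs ! i) \<longleftrightarrow> length xs - i \<le> length (filter P xs)"
  using assms prime_filter_kth_median[of P "Suc i" xs] by (simp add: medians_def del: upt_Suc)

text \<open>Since prime filters separate points, the medians depend on a tuple only through these
  counts.\<close>

lemma medians_eqI: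
  assumes "length xs = length ys"
    and "\<And>P. prime_filter P \<Longrightarrow> length (filter P xs) = length (filter P ys)"
  shows "medians xs = medians ys"
proof (rule nth_equalityI)
  show "medians xs ! i = medians ys ! i" if "i < length (medians xs)" for i
  proof (rule eq_by_prime_filters)
    show "P (medians xs ! i) \<longleftrightarrow> P (medians ys ! i)" if P: "prime_filter P" for P
      using \<open>i < length (medians xs)\<close> assms(1) assms(2)[OF P]
      by (simp add: prime_filter_nth_medians[OF P])
  qed
qed (simp add: assms(1))

text \<open>Along a chain the positions where \<open>P\<close> holds form a final segment, as
  \<open>P\<close> is upward closed; its size determines it.\<close>

lemma prime_filter_nth_sorted:
  assumes "prime_filter P" "sorted_wrt (\<le>) xs" "i < length xs"
  shows "P (xs ! i) \<longleftrightarrow> length xs - i \<le> length (filter P xs)"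
  using assms(2,3)
proof (induction xs arbitrary: i)
  case (Cons x xs)
  show ?case
  proof (cases "P x")
    case True
    then have all: "\<forall>y\<in>set (x # xs). P y"
      using Cons.prems(1) prime_filter_mono[OF assms(1)] by auto
    then have "filter P (x # xs) = x # xs"
      by (simp only: filter_id_conv)
    moreover have "P ((x # xs) ! i)"
      using all nth_mem[OF Cons.prems(2)] by blast
    ultimately show ?thesis
      by simp
  next
    case False
    \<comment> \<open>Settles \<open>i = 0\<close>: the threshold there is the full length of
      \<open>x # xs\<close>, which the count over \<open>xs\<close> cannot reach.\<close>
    have "length (filter P xs) \<le> length xs"
      by (rule length_filter_le)
    with False Cons show ?thesis
      by (cases i) (simp_all add: not_le less_Suc_eq_le)
  qed
qed simp

lemma medians_sorted:
  assumes "sorted_wrt (\<le>) xs"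
  shows "medians xs = xs"
proof (rule nth_equalityI)
  show "medians xs ! i = xs ! i" if "i < length (medians xs)" for i
  proof (rule eq_by_prime_filters)
    show "P (medians xs ! i) \<longleftrightarrow> P (xs ! i)" if P: "prime_filter P" for P
      using \<open>i < length (medians xs)\<close> assms
      by (simp add: prime_filter_nth_medians[OF P] prime_filter_nth_sorted[OF P])
  qed
qed simp

section \<open>Insertion sort by meets and joins\<close>

text \<open>The meet stays in place and the join is carried on, so incomparable elements cause no
  case distinction.\<close>

fun lattice_insort :: "'a::lattice \<Rightarrow> 'a list \<Rightarrow> 'a list" where
  "lattice_insort x [] = [x]"
| "lattice_insort x (y # ys) = inf x y # lattice_insort (sup x y) ys"

lemma length_lattice_insort [simp]: "length (lattice_insort x ys) = Suc (length ys)"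
  by (induction ys arbitrary: x) simp_all

text \<open>Serves to show that the head \<open>inf x y\<close> left behind lies below everything
  after it.\<close>

lemma lattice_insort_lower_bound:
  "z \<le> x \<Longrightarrow> \<forall>y\<in>set ys. z \<le> y \<Longrightarrow> \<forall>y\<in>set (lattice_insort x ys). z \<le> y"
proof (induction ys arbitrary: x)
  case (Cons y ys)
  have "\<forall>w\<in>set (lattice_insort (sup x y) ys). z \<le> w"
    by (rule Cons.IH) (use Cons.prems in \<open>auto intro: le_supI1\<close>)
  with Cons.prems show ?case
    by simp
qed simp

lemma sorted_lattice_insort:
  "sorted_wrt (\<le>) ys \<Longrightarrow> sorted_wrt (\<le>) (lattice_insort x ys)"
proof (induction ys arbitrary: x)
  case (Cons y ys)
  have "\<forall>z\<in>set (lattice_insort (sup x y) ys). inf x y \<le> z"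
    using Cons.prems by (intro lattice_insort_lower_bound) (auto intro: le_supI1 le_infI2)
  with Cons show ?case by simp
qed simp

lemma filter_lattice_insort:
  assumes "prime_filter P"
  shows "length (filter P (lattice_insort x ys)) = length (filter P (x # ys))"
  by (induction ys arbitrary: x)
     (auto simp: prime_filter_inf[OF assms] prime_filter_sup[OF assms])

definition lattice_sort :: "'a::lattice list \<Rightarrow> 'a list" where
  "lattice_sort xs = foldr lattice_insort xs []"

lemma lattice_sort_simps [simp]:
  "lattice_sort [] = []" "lattice_sort (x # xs) = lattice_insort x (lattice_sort xs)"
  by (simp_all add: lattice_sort_def)

lemma length_lattice_sort [simp]: "length (lattice_sort xs) = length xs"
  by (induction xs) simp_all

lemma sorted_lattice_sort: "sorted_wrt (\<le>) (lattice_sort xs)"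
  by (induction xs) (simp_all add: sorted_lattice_insort)

lemma filter_lattice_sort:
  "prime_filter P \<Longrightarrow> length (filter P (lattice_sort xs)) = length (filter P xs)"
  by (induction xs) (simp_all add: filter_lattice_insort)

text \<open>Sorting keeps the counts, hence the medians, and yields a chain, which is its own tuple
  of medians.\<close>

lemma medians_eq_lattice_sort:
  fixes xs :: "'a::distrib_lattice list"
  shows "medians xs = lattice_sort xs"
proof -
  have "medians xs = medians (lattice_sort xs)"
    by (rule medians_eqI) (simp_all add: filter_lattice_sort)
  then show ?thesis
    by (simp add: medians_sorted sorted_lattice_sort)
qed

section \<open>Comparators at two positions\<close>

text \<open>A gate of a sorting network; the meet goes to \<open>i\<close> even when
  \<open>j < i\<close>.\<close>

definition comparator :: "nat \<Rightarrow> nat \<Rightarrow> 'a::lattice list \<Rightarrow> 'a list" where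
  "comparator i j xs = xs[i := inf (xs ! i) (xs ! j), j := sup (xs ! i) (xs ! j)]"

lemma length_comparator [simp]: "length (comparator i j xs) = length xs"
  by (simp add: comparator_def)

lemma comparator_same [simp]: "comparator i i xs = xs"
  by (simp add: comparator_def)

lemma nth_comparator:
  assumes "i < length xs" "j < length xs" "i \<noteq> j" "k < length xs"
  shows "comparator i j xs ! k =
    (if k = i then inf (xs ! i) (xs ! j) else if k = j then sup (xs ! i) (xs ! j) else xs ! k)"
  using assms by (simp add: comparator_def nth_list_update)

lemma comparator_Cons: "comparator (Suc i) (Suc j) (x # xs) = x # comparator i j xs"
  by (simp add: comparator_def)

lemma comparator_append:
  "i < length xs \<Longrightarrow> j < length xs \<Longrightarrow> comparator i j (xs @ ys) = comparator i j xs @ ys"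
  by (simp add: comparator_def list_update_append nth_append)

lemma filter_comparator:
  assumes P: "prime_filter P" and ij: "i < length xs" "j < length xs"
  shows "length (filter P (comparator i j xs)) = length (filter P xs)"
proof (cases "i = j")
  case False
  let ?f = "\<lambda>ys k. of_bool (P (ys ! k)) :: nat"
  \<comment> \<open>The count splits so that a comparator affects only the first two summands, whose
    total it preserves.\<close>
  have sum: "length (filter P ys) = ?f ys i + ?f ys j + sum (?f ys) ({..<length ys} - {i, j})"
    if "length ys = length xs" for ys
  proof -
    have "length (filter P ys) = sum (?f ys) {..<length ys}"
      by (simp add: length_filter_conv_card sum.If_cases of_bool_def Collect_conj_eq lessThan_def)
    also have "\<dots> = sum (?f ys) {i, j} + sum (?f ys) ({..<length ys} - {i, j})"
      using ij that by (subst sum.subset_diff[of "{i, j}"]) (simp_all add: add.commute)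
    finally show ?thesis
      using False by simp
  qed
  have "sum (?f (comparator i j xs)) ({..<length xs} - {i, j}) = sum (?f xs) ({..<length xs} - {i, j})"
    using ij False by (intro sum.cong) (auto simp: nth_comparator)
  then show ?thesis
    using ij False
    by (auto simp: sum nth_comparator prime_filter_inf[OF P] prime_filter_sup[OF P])
qed simp

lemma medians_comparator:
  fixes xs :: "'a::distrib_lattice list"
  assumes "i < length xs" "j < length xs"
  shows "medians (comparator i j xs) = medians xs"
  using assms by (intro medians_eqI) (simp_all add: filter_comparator)

section \<open>Maps invariant under comparators\<close>

definition comparator_invariant :: "nat \<Rightarrow> ('a::lattice list \<Rightarrow> 'b) \<Rightarrow> bool" where
  "comparator_invariant n T \<longleftrightarrow>
     (\<forall>xs i j. length xs = n \<longrightarrow> i < n \<longrightarrow> j < n \<longrightarrow> T xs = T (comparator i j xs))"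

lemma comparator_invariantD:
  assumes "comparator_invariant n T" "length xs = n" "i < n" "j < n"
  shows "T (comparator i j xs) = T xs"
  using assms unfolding comparator_invariant_def by metis

text \<open>Freezing the first argument lets inductions along the list vary the map as well.\<close>

lemma comparator_invariant_Cons:
  assumes "comparator_invariant (Suc n) T"
  shows "comparator_invariant n (\<lambda>xs. T (x # xs))"
  unfolding comparator_invariant_def
proof (intro allI impI)
  fix xs :: "'a list" and i j
  assume "length xs = n" "i < n" "j < n"
  then show "T (x # xs) = T (x # comparator i j xs)"
    using comparator_invariantD[OF assms, of "x # xs" "Suc i" "Suc j"]
    by (simp add: comparator_Cons)
qed

text \<open>Freezing the last arguments allows sorting an initial segment only.\<close>

lemma comparator_invariant_append:
  assumes "comparator_invariant n T" "m + length ys = n"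
  shows "comparator_invariant m (\<lambda>xs. T (xs @ ys))"
  unfolding comparator_invariant_def
proof (intro allI impI)
  fix xs :: "'a list" and i j
  assume "length xs = m" "i < m" "j < m"
  then show "T (xs @ ys) = T (comparator i j xs @ ys)"
    using comparator_invariantD[OF assms(1), of "xs @ ys" i j] assms(2)
    by (simp add: comparator_append)
qed

text \<open>One step of the insertion is the comparator at positions 0 and 1; the rest is the
  induction hypothesis with the head frozen.\<close>

lemma comparator_invariant_insort:
  assumes "comparator_invariant (Suc (length ys)) T"
  shows "T (lattice_insort x ys) = T (x # ys)"
  using assms
proof (induction ys arbitrary: x T)
  case (Cons y ys)
  have "T (x # y # ys) = T (inf x y # sup x y # ys)"
    using comparator_invariantD[OF Cons.prems, of "x # y # ys" 0 1]
    by (simp add: comparator_def)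
  also have "\<dots> = T (inf x y # lattice_insort (sup x y) ys)"
    using Cons.IH[OF comparator_invariant_Cons, of T "inf x y" "sup x y"] Cons.prems by simp
  finally show ?case by simp
qed simp

lemma comparator_invariant_sort:
  assumes "comparator_invariant (length xs) T"
  shows "T (lattice_sort xs) = T xs"
  using assms
proof (induction xs arbitrary: T)
  case (Cons x xs)
  then show ?case
    using comparator_invariant_insort[of "lattice_sort xs" T x]
      Cons.IH[OF comparator_invariant_Cons, of T x] by simp
qed simp

lemma comparator_invariant_medians:
  fixes xs :: "'a::distrib_lattice list"
  assumes "comparator_invariant (length xs) T"
  shows "T (medians xs) = T xs"
  using assms by (simp add: medians_eq_lattice_sort comparator_invariant_sort)

text \<open>Forwards, a tuple and its image under a comparator have the same medians; backwards,
  comparators lead to the medians by sorting.\<close>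

lemma total_orderization_invariant_iff_comparator_invariant:
  "total_orderization_invariant n T \<longleftrightarrow> comparator_invariant n T"
proof
  assume "total_orderization_invariant n T"
  then show "comparator_invariant n T"
    unfolding total_orderization_invariant_def comparator_invariant_def
    by (metis length_comparator medians_comparator)
next
  assume "comparator_invariant n T"
  then show "total_orderization_invariant n T"
    unfolding total_orderization_invariant_def by (metis comparator_invariant_medians)
qed

section \<open>Comparators and permutations\<close>

lemma comparator_invariant_imp_symmetric:
  assumes inv: "comparator_invariant n T"
  shows "symmetric_map n T"
proof -
  \<comment> \<open>A tuple and its transposition become equal after the comparators at \<open>(a, b)\<close>.\<close>
  have transp: "T (permute_list (Transposition.transpose a b) xs) = T xs"
    if "a < n" "b < n" "a \<noteq> b" "length xs = n" for a b xs
  proof -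
    let ?t = "Transposition.transpose a b"
    have t: "?t permutes {..<length xs}"
      using that by (intro permutes_swap_id) auto
    have nth: "permute_list ?t xs ! k = xs ! ?t k" if "k < n" for k
      using permute_list_nth[OF t] that \<open>length xs = n\<close> by simp
    have "comparator a b (permute_list ?t xs) = comparator a b xs"
      using that nth
      by (intro nth_equalityI) (auto simp: nth_comparator inf.commute sup.commute)
    then show ?thesis
      using comparator_invariantD[OF inv] that by (metis length_permute_list)
  qed
  \<comment> \<open>Induction over products of transpositions. The quantifier over \<open>xs\<close>
    is there because the hypothesis for \<open>p\<close> is applied to the transposed tuple.\<close>
  have "\<forall>xs. length xs = n \<longrightarrow> T (permute_list p xs) = T xs" if "p permutes {..<n}" for p
    using that finite_lessThan
  proof (induction rule: permutes_induct)
    case (swap a b p)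
    show ?case
    proof (intro allI impI)
      fix xs :: "'a list"
      assume "length xs = n"
      then show "T (permute_list (Transposition.transpose a b \<circ> p) xs) = T xs"
        using swap transp[of a b xs] by (subst permute_list_compose) simp_all
    qed
  qed simp
  then show ?thesis
    by (simp add: symmetric_map_def)
qed

lemma ex_permutes_two_points:
  assumes "i < n" "j < n" "i \<noteq> j"
  shows "\<exists>p. p permutes {..<n} \<and> p 0 = i \<and> p 1 = (j::nat)"
proof -
  let ?t = "Transposition.transpose"
  \<comment> \<open>The inner factor sends 1 to the preimage of \<open>j\<close> under the outer
    one. As \<open>i \<noteq> j\<close>, that preimage is not 0, so 0 stays fixed until the outer
    factor sends it to \<open>i\<close>.\<close>
  let ?p = "?t i 0 \<circ> ?t 1 (?t i 0 j)"
  have "?p permutes {..<n}"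
    using assms by (intro permutes_compose permutes_swap_id) (auto simp: transpose_def)
  moreover have "?p 0 = i" "?p 1 = j"
    using assms by (auto simp: transpose_def)
  ultimately show ?thesis by blast
qed

text \<open>A permutation brings the entries at \<open>i\<close> and \<open>j\<close> to the front,
  where \<open>first\<close> applies; symmetry then undoes the permutation.\<close>

lemma symmetric_imp_comparator_invariant:
  assumes sym: "symmetric_map n T"
    and first: "\<And>x1 x2 xs. length (x1 # x2 # xs) = n \<Longrightarrow>
      T (x1 # x2 # xs) = T (inf x1 x2 # sup x1 x2 # xs)"
  shows "comparator_invariant n T"
  unfolding comparator_invariant_def
proof (intro allI impI)
  fix xs :: "'a list" and i j
  assume len: "length xs = n" and ij: "i < n" "j < n"
  show "T xs = T (comparator i j xs)"
  proof (cases "i = j")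
    case False
    with ij obtain p where p: "p permutes {..<n}" "p 0 = i" "p 1 = j"
      using ex_permutes_two_points by blast
    let ?ys = "permute_list p xs"
    have "1 < n"
      using ij False by simp
    \<comment> \<open>Injectivity of \<open>p\<close> ensures that positions other than 0 and 1 read
      entries that the comparator at \<open>i\<close>, \<open>j\<close> leaves alone.\<close>
    have p_eq: "p k = i \<longleftrightarrow> k = 0" "p k = j \<longleftrightarrow> k = 1" for k
      using p permutes_inj[OF p(1)] by (metis injD)+
    have p_less: "p k < n" if "k < n" for k
      using permutes_in_image[OF p(1), of k] that by simp
    have "length ?ys = n"
      by (simp add: len)
    then obtain a b zs where ys: "?ys = a # b # zs"
      using \<open>1 < n\<close> by (cases ?ys; cases "tl ?ys") auto
    have "T xs = T ?ys"
      using sym p(1) len by (simp add: symmetric_map_def)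
    also have "\<dots> = T (comparator 0 1 ?ys)"
      using first[of a b zs] \<open>length ?ys = n\<close> by (simp add: ys comparator_def)
    \<comment> \<open>Conjugation by \<open>p\<close> turns the comparator at \<open>i\<close>,
      \<open>j\<close> into the one at 0, 1.\<close>
    also have "comparator 0 1 ?ys = permute_list p (comparator i j xs)"
    proof (rule nth_equalityI)
      fix k
      assume "k < length (comparator 0 1 ?ys)"
      then have "k < n"
        by (simp add: len)
      have nth: "permute_list p zs ! l = zs ! p l" if "length zs = n" "l < n" for zs :: "'a list" and l
        using p(1) that by (simp add: permute_list_nth)
      show "comparator 0 1 ?ys ! k = permute_list p (comparator i j xs) ! k"
        using len ij False \<open>1 < n\<close> \<open>k < n\<close> p_less[of k]
        by (simp add: nth nth_comparator p_eq p(2,3) flip: One_nat_def)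
    qed simp
    also have "T \<dots> = T (comparator i j xs)"
      using sym p(1) len by (simp add: symmetric_map_def)
    finally show ?thesis .
  qed simp
qed

section \<open>The equivalence of the four conditions\<close>

theorem theorem3p5:
  fixes T :: "'a::distrib_lattice list \<Rightarrow> 'b" and A :: "'b set" and n :: nat
  assumes "A \<noteq> {}"
    and "n \<ge> 2"
    and "T \<in> {xs. length xs = n} \<rightarrow> A"
  shows
    "(total_orderization_invariant n T \<longleftrightarrow>
        symmetric_map n T \<and>
        (\<forall>x1 x2 xs. length (x1 # x2 # xs) = n \<longrightarrow>
            T (x1 # x2 # xs) = T (inf x1 x2 # sup x1 x2 # xs))) \<and>
     (total_orderization_invariant n T \<longleftrightarrow>
        (\<forall>xs i j. length xs = n \<longrightarrow> i < n \<longrightarrow> j < n \<longrightarrow>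
            T xs = T (xs[i := inf (xs ! i) (xs ! j), j := sup (xs ! i) (xs ! j)]))) \<and>
     (total_orderization_invariant n T \<longleftrightarrow>
        (\<forall>xs m. length xs = n \<longrightarrow> m \<in> {2..n} \<longrightarrow>
            T xs = T (medians (take m xs) @ drop m xs)))"
proof (intro conjI)
  show "total_orderization_invariant n T \<longleftrightarrow>
        symmetric_map n T \<and>
        (\<forall>x1 x2 xs. length (x1 # x2 # xs) = n \<longrightarrow>
            T (x1 # x2 # xs) = T (inf x1 x2 # sup x1 x2 # xs))"
    (is "_ \<longleftrightarrow> _ \<and> ?first")
    unfolding total_orderization_invariant_iff_comparator_invariant
  proof
    assume inv: "comparator_invariant n T"
    have ?first
    proof (intro allI impI)
      fix x1 x2 :: 'a and xs
      assume "length (x1 # x2 # xs) = n"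
      then show "T (x1 # x2 # xs) = T (inf x1 x2 # sup x1 x2 # xs)"
        using comparator_invariantD[OF inv, of "x1 # x2 # xs" 0 1]
        by (auto simp: comparator_def)
    qed
    with comparator_invariant_imp_symmetric[OF inv] show "symmetric_map n T \<and> ?first"
      by (rule conjI)
  next
    assume "symmetric_map n T \<and> ?first"
    then show "comparator_invariant n T"
      by (intro symmetric_imp_comparator_invariant) blast+
  qed
next
  show "total_orderization_invariant n T \<longleftrightarrow>
        (\<forall>xs i j. length xs = n \<longrightarrow> i < n \<longrightarrow> j < n \<longrightarrow>
            T xs = T (xs[i := inf (xs ! i) (xs ! j), j := sup (xs ! i) (xs ! j)]))"
    unfolding total_orderization_invariant_iff_comparator_invariant
    by (simp add: comparator_invariant_def comparator_def)
next
  show "total_orderization_invariant n T \<longleftrightarrow>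
        (\<forall>xs m. length xs = n \<longrightarrow> m \<in> {2..n} \<longrightarrow>
            T xs = T (medians (take m xs) @ drop m xs))"
    (is "_ \<longleftrightarrow> ?initial")
  proof
    assume "total_orderization_invariant n T"
    then have inv: "comparator_invariant n T"
      by (simp add: total_orderization_invariant_iff_comparator_invariant)
    show ?initial
    proof (intro allI impI)
      fix xs :: "'a list" and m
      assume "length xs = n" "m \<in> {2..n}"
      \<comment> \<open>With the last \<open>n - m\<close> arguments frozen, the initial segment can
        be replaced by its medians.\<close>
      then have "comparator_invariant (length (take m xs)) (\<lambda>ys. T (ys @ drop m xs))"
        by (intro comparator_invariant_append[OF inv]) simp
      then show "T xs = T (medians (take m xs) @ drop m xs)"
        by (subst comparator_invariant_medians) simp_all
    qed
  next
    assume ?initial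
    \<comment> \<open>The case \<open>m = n\<close>, which lies in the range \<open>{2..n}\<close>
      because \<open>n \<ge> 2\<close>.\<close>
    then show "total_orderization_invariant n T"
      using assms(2) by (force simp: total_orderization_invariant_def)
  qed
qed

end
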